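(* Every finite semigroup divides an iterated $\lambda\rho$-product whose factors are finite simple groups and a two-element semilattice.
   Context: Composition convention: $(g\circ f)(x)=g(f(x))$. A $\lambda\rho$-system over a semigroup $\mathbf{S}$ (with universe $S$) consists of sets $(I[s])_{s\in S}$ (possibly empty) and maps $\lambda[a,b]\colon I[ab]\to I[a]$, $\rho[a,b]\colon I[ab]\to I[b]$ for $a,b\in S$, such that for all $a,b,c\in S$: ($\alpha$) $\lambda[a,b]\circ\lambda[ab,c]=\lambda[a,bc]$; ($\beta$) $\rho[b,c]\circ\rho[a,bc]=\rho[ab,c]$; ($\gamma$) $\rho[a,b]\circ\lambda[ab,c]=\lambda[b,c]\circ\rho[a,bc]$. For a semigroup $\mathbf{H}$ and a $\lambda\rho$-system $\mathcal{S}$ over $\mathbf{S}$, the $\lambda\rho$-product $\mathbf{H}^{[\mathcal{S}]}$ (a $\lambda\rho$-product of $\mathbf{H}$ over $\mathbf{S}$) is the semigroup with universe $\{(x,a)\colon a\in S,\ x\in H^{I[a]}\}$ and operation $(x,a)\star(y,b)=\bigl((x\circ\lambda[a,b])\cdot(y\circ\rho[a,b]),\,ab\bigr)$, where $\cdot$ is the pointwise product. Iterated $\lambda\rho$-products with factors in a class $\mathcal{K}$ of semigroups form the smallest class of semigroups containing $\mathcal{K}$ and containing $\mathbf{H}^{[\mathcal{S}]}$ whenever it contains $\mathbf{H}$ and $\mathbf{S}$ and $\mathcal{S}$ is a $\lambda\rho$-system over $\mathbf{S}$. Here $\mathcal{K}$ consists of the finite simple groups and the two-element semilattice $(\{0,1\},\vee)$.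 A semigroup $\mathbf{A}$ divides a semigroup $\mathbf{B}$ if $\mathbf{A}$ is a homomorphic image of a subsemigroup of $\mathbf{B}$. *)

theory Defs
  imports "HOL-Algebra.SimpleGroups"
begin

record 'a semigrp = "'a partial_object" +
  sgmult :: "'a \<Rightarrow> 'a \<Rightarrow> 'a" (infixl "\<star>\<index>" 70)

locale semigrp =
  fixes S :: "'a semigrp" (structure)
  assumes nonempty: "carrier S \<noteq> {}"
    and closed: "\<lbrakk>a \<in> carrier S; b \<in> carrier S\<rbrakk> \<Longrightarrow> a \<star> b \<in> carrier S"
    and assoc: "\<lbrakk>a \<in> carrier S; b \<in> carrier S; c \<in> carrier S\<rbrakk> \<Longrightarrow> (a \<star> b) \<star> c = a \<star> (b \<star> c)"

definition semigrp_hom :: "'a semigrp \<Rightarrow> 'b semigrp \<Rightarrow> ('a \<Rightarrow> 'b) set" where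
  "semigrp_hom A B = {f. f \<in> carrier A \<rightarrow> carrier B \<and>
     (\<forall>x\<in>carrier A. \<forall>y\<in>carrier A. f (x \<star>\<^bsub>A\<^esub> y) = f x \<star>\<^bsub>B\<^esub> f y)}"

definition semigrp_iso :: "'a semigrp \<Rightarrow> 'b semigrp \<Rightarrow> ('a \<Rightarrow> 'b) set" where
  "semigrp_iso A B = {f \<in> semigrp_hom A B. bij_betw f (carrier A) (carrier B)}"

definition subsemigrp :: "'a set \<Rightarrow> 'a semigrp \<Rightarrow> bool" where
  "subsemigrp T B \<longleftrightarrow> T \<noteq> {} \<and> T \<subseteq> carrier B \<and> (\<forall>x\<in>T. \<forall>y\<in>T. x \<star>\<^bsub>B\<^esub> y \<in> T)"

definition divides :: "'a semigrp \<Rightarrow> 'b semigrp \<Rightarrow> bool" where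
  "divides A B \<longleftrightarrow> (\<exists>T f. subsemigrp T B \<and> f \<in> semigrp_hom (B\<lparr>carrier := T\<rparr>) A \<and> f ` T = carrier A)"

text \<open>The index type \<^typ>\<open>'i\<close> only bounds the cardinality of the sets \<open>I s\<close>; the maps
  \<open>\<lambda>[a,b]\<close> and \<open>\<rho>[a,b]\<close> are \<open>l a b\<close> and \<open>r a b\<close>, whose values outside \<open>I (a \<star> b)\<close> are irrelevant.\<close>

locale lr_system = semigrp S for S :: "'s semigrp" (structure) +
  fixes I :: "'s \<Rightarrow> 'i set"
    and l r :: "'s \<Rightarrow> 's \<Rightarrow> 'i \<Rightarrow> 'i"
  assumes l_map: "\<lbrakk>a \<in> carrier S; b \<in> carrier S\<rbrakk> \<Longrightarrow> l a b \<in> I (a \<star> b) \<rightarrow> I a"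
    and r_map: "\<lbrakk>a \<in> carrier S; b \<in> carrier S\<rbrakk> \<Longrightarrow> r a b \<in> I (a \<star> b) \<rightarrow> I b"
    and alpha: "\<lbrakk>a \<in> carrier S; b \<in> carrier S; c \<in> carrier S; i \<in> I (a \<star> b \<star> c)\<rbrakk>
      \<Longrightarrow> l a b (l (a \<star> b) c i) = l a (b \<star> c) i"
    and beta: "\<lbrakk>a \<in> carrier S; b \<in> carrier S; c \<in> carrier S; i \<in> I (a \<star> b \<star> c)\<rbrakk>
      \<Longrightarrow> r b c (r a (b \<star> c) i) = r (a \<star> b) c i"
    and gamma: "\<lbrakk>a \<in> carrier S; b \<in> carrier S; c \<in> carrier S; i \<in> I (a \<star> b \<star> c)\<rbrakk>
      \<Longrightarrow> r a b (l (a \<star> b) c i) = l b c (r a (b \<star> c) i)"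

definition lr_product ::
  "'h semigrp \<Rightarrow> 's semigrp \<Rightarrow> ('s \<Rightarrow> 'i set) \<Rightarrow> ('s \<Rightarrow> 's \<Rightarrow> 'i \<Rightarrow> 'i) \<Rightarrow> ('s \<Rightarrow> 's \<Rightarrow> 'i \<Rightarrow> 'i)
     \<Rightarrow> (('i \<Rightarrow> 'h) \<times> 's) semigrp" where
  "lr_product H S I l r =
     \<lparr>carrier = {(x, a). a \<in> carrier S \<and> x \<in> I a \<rightarrow>\<^sub>E carrier H},
      sgmult = (\<lambda>(x, a) (y, b).
        ((\<lambda>i\<in>I (a \<star>\<^bsub>S\<^esub> b). x (l a b i) \<star>\<^bsub>H\<^esub> y (r a b i)), a \<star>\<^bsub>S\<^esub> b))\<rparr>"

lemma lr_product_semigrp: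
  assumes "semigrp H" and "lr_system S I l r"
  shows "semigrp (lr_product H S I l r)"
proof -
  interpret H: semigrp H by fact
  interpret S: lr_system S I l r by fact
  have ne: "\<exists>x. x \<in> I a \<rightarrow>\<^sub>E carrier H" for a
    using H.nonempty by (metis PiE_eq_empty_iff ex_in_conv)
  show ?thesis
  proof
    obtain a where a: "a \<in> carrier S" using S.nonempty by blast
    obtain x where "x \<in> I a \<rightarrow>\<^sub>E carrier H" using ne by blast
    with a have "(x, a) \<in> carrier (lr_product H S I l r)" by (simp add: lr_product_def)
    then show "carrier (lr_product H S I l r) \<noteq> {}" by blast
  next
    fix p q
    assume pq: "p \<in> carrier (lr_product H S I l r)" "q \<in> carrier (lr_product H S I l r)"
    obtain x a y b where e: "p = (x, a)" "q = (y, b)"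
      by (metis prod.exhaust)
    have m: "a \<in> carrier S" "b \<in> carrier S" "x \<in> I a \<rightarrow>\<^sub>E carrier H" "y \<in> I b \<rightarrow>\<^sub>E carrier H"
      using pq by (auto simp: e lr_product_def)
    have "x (l a b i) \<star>\<^bsub>H\<^esub> y (r a b i) \<in> carrier H" if "i \<in> I (a \<star>\<^bsub>S\<^esub> b)" for i
      using H.closed PiE_mem[OF m(3)] PiE_mem[OF m(4)]
        funcset_mem[OF S.l_map[OF m(1,2)] that] funcset_mem[OF S.r_map[OF m(1,2)] that] by blast
    then show "p \<star>\<^bsub>lr_product H S I l r\<^esub> q \<in> carrier (lr_product H S I l r)"
      using S.closed[OF m(1,2)] by (simp add: e lr_product_def)
  next
    fix p q s
    assume pqs: "p \<in> carrier (lr_product H S I l r)" "q \<in> carrier (lr_product H S I l r)"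
      "s \<in> carrier (lr_product H S I l r)"
    obtain x a y b z c where e: "p = (x, a)" "q = (y, b)" "s = (z, c)"
      by (metis prod.exhaust)
    have m: "a \<in> carrier S" "b \<in> carrier S" "c \<in> carrier S"
      "x \<in> I a \<rightarrow>\<^sub>E carrier H" "y \<in> I b \<rightarrow>\<^sub>E carrier H" "z \<in> I c \<rightarrow>\<^sub>E carrier H"
      using pqs by (auto simp: e lr_product_def)
    note assocS = S.assoc[OF m(1-3)]
    have "x (l a b (l (a \<star>\<^bsub>S\<^esub> b) c i)) \<star>\<^bsub>H\<^esub> y (r a b (l (a \<star>\<^bsub>S\<^esub> b) c i)) \<star>\<^bsub>H\<^esub> z (r (a \<star>\<^bsub>S\<^esub> b) c i)
        = x (l a (b \<star>\<^bsub>S\<^esub> c) i) \<star>\<^bsub>H\<^esub>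
          (y (l b c (r a (b \<star>\<^bsub>S\<^esub> c) i)) \<star>\<^bsub>H\<^esub> z (r b c (r a (b \<star>\<^bsub>S\<^esub> c) i)))"
      if i: "i \<in> I (a \<star>\<^bsub>S\<^esub> b \<star>\<^bsub>S\<^esub> c)" for i
    proof -
      have bc: "b \<star>\<^bsub>S\<^esub> c \<in> carrier S" using m S.closed by blast
      have i': "i \<in> I (a \<star>\<^bsub>S\<^esub> (b \<star>\<^bsub>S\<^esub> c))" using i assocS by simp
      have li: "l a (b \<star>\<^bsub>S\<^esub> c) i \<in> I a" and ri: "r a (b \<star>\<^bsub>S\<^esub> c) i \<in> I (b \<star>\<^bsub>S\<^esub> c)"
        using S.l_map[OF m(1) bc] S.r_map[OF m(1) bc] i' by auto
      have "l b c (r a (b \<star>\<^bsub>S\<^esub> c) i) \<in> I b" "r b c (r a (b \<star>\<^bsub>S\<^esub> c) i) \<in> I c"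
        using S.l_map[OF m(2,3)] S.r_map[OF m(2,3)] ri by auto
      then show ?thesis
        using li PiE_mem[OF m(4)] PiE_mem[OF m(5)] PiE_mem[OF m(6)]
        by (simp add: S.alpha[OF m(1-3) i] S.gamma[OF m(1-3) i]
            S.beta[OF m(1-3) i, symmetric] H.assoc)
    qed
    moreover have "l (a \<star>\<^bsub>S\<^esub> b) c i \<in> I (a \<star>\<^bsub>S\<^esub> b)" "r a (b \<star>\<^bsub>S\<^esub> c) i \<in> I (b \<star>\<^bsub>S\<^esub> c)"
      if i: "i \<in> I (a \<star>\<^bsub>S\<^esub> b \<star>\<^bsub>S\<^esub> c)" for i
      using i funcset_mem[OF S.l_map[OF S.closed[OF m(1,2)] m(3)]]
        funcset_mem[OF S.r_map[OF m(1) S.closed[OF m(2,3)]]] by (simp_all add: assocS)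
    ultimately have "(\<lambda>i\<in>I (a \<star>\<^bsub>S\<^esub> b \<star>\<^bsub>S\<^esub> c). (\<lambda>i\<in>I (a \<star>\<^bsub>S\<^esub> b). x (l a b i) \<star>\<^bsub>H\<^esub> y (r a b i))
          (l (a \<star>\<^bsub>S\<^esub> b) c i) \<star>\<^bsub>H\<^esub> z (r (a \<star>\<^bsub>S\<^esub> b) c i))
        = (\<lambda>i\<in>I (a \<star>\<^bsub>S\<^esub> b \<star>\<^bsub>S\<^esub> c). x (l a (b \<star>\<^bsub>S\<^esub> c) i) \<star>\<^bsub>H\<^esub>
          (\<lambda>i\<in>I (b \<star>\<^bsub>S\<^esub> c). y (l b c i) \<star>\<^bsub>H\<^esub> z (r b c i)) (r a (b \<star>\<^bsub>S\<^esub> c) i))"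
      by (intro restrict_ext) simp
    then show "p \<star>\<^bsub>lr_product H S I l r\<^esub> q \<star>\<^bsub>lr_product H S I l r\<^esub> s
        = p \<star>\<^bsub>lr_product H S I l r\<^esub> (q \<star>\<^bsub>lr_product H S I l r\<^esub> s)"
      by (simp add: e lr_product_def assocS)
  qed
qed

text \<open>The carrier of a product lives on a larger type than those of its factors, so iterating needs
  one type into which \<open>('i \<Rightarrow> 'u) \<times> 'u\<close> embeds, where \<open>'u\<close> is the type itself. The free datatype
  below has this property; \<open>Elem\<close> is the (injective) pairing, and the atoms make it infinite, so that
  it contains isomorphic copies of all finite semigroups.\<close>

datatype 'i elem = Atom nat | Elem "'i \<Rightarrow> 'i elem" "'i elem"

definition transport :: "('a \<Rightarrow> 'b) \<Rightarrow> 'a semigrp \<Rightarrow> 'b semigrp" where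
  "transport f A = \<lparr>carrier = f ` carrier A,
     sgmult = (\<lambda>u v. f (inv_into (carrier A) f u \<star>\<^bsub>A\<^esub> inv_into (carrier A) f v))\<rparr>"

lemma transport_iso:
  assumes "semigrp A" and "inj_on f (carrier A)"
  shows "f \<in> semigrp_iso A (transport f A)"
  using assms inv_into_f_f[OF assms(2)]
  by (simp add: semigrp_iso_def semigrp_hom_def transport_def bij_betw_def)

definition elem_lr_product ::
  "'i elem semigrp \<Rightarrow> 'i elem semigrp \<Rightarrow> ('i elem \<Rightarrow> 'i set) \<Rightarrow> ('i elem \<Rightarrow> 'i elem \<Rightarrow> 'i \<Rightarrow> 'i)
     \<Rightarrow> ('i elem \<Rightarrow> 'i elem \<Rightarrow> 'i \<Rightarrow> 'i) \<Rightarrow> 'i elem semigrp" where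
  "elem_lr_product H S I l r = transport (\<lambda>(x, a). Elem x a) (lr_product H S I l r)"

lemma elem_lr_product_iso:
  assumes "semigrp H" and "lr_system S I l r"
  shows "(\<lambda>(x, a). Elem x a) \<in> semigrp_iso (lr_product H S I l r) (elem_lr_product H S I l r)"
  unfolding elem_lr_product_def
  by (rule transport_iso[OF lr_product_semigrp[OF assms]]) (auto simp: inj_on_def)

inductive iterated_lr_product :: "('i elem semigrp \<Rightarrow> bool) \<Rightarrow> 'i elem semigrp \<Rightarrow> bool"
  for K where
  factor: "K H \<Longrightarrow> iterated_lr_product K H"
| product: "\<lbrakk>iterated_lr_product K H; iterated_lr_product K S; lr_system S I l r\<rbrakk>
    \<Longrightarrow> iterated_lr_product K (elem_lr_product H S I l r)"

definition finite_simple_group :: "'a semigrp \<Rightarrow> bool" where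
  "finite_simple_group F \<longleftrightarrow> (\<exists>G :: 'a monoid. simple_group G \<and> finite (carrier G) \<and>
     F = \<lparr>carrier = carrier G, sgmult = monoid.mult G\<rparr>)"

definition join_semilattice_2 :: "bool semigrp" where
  "join_semilattice_2 = \<lparr>carrier = UNIV, sgmult = (\<or>)\<rparr>"

definition two_element_semilattice :: "'a semigrp \<Rightarrow> bool" where
  "two_element_semilattice F \<longleftrightarrow> semigrp_iso join_semilattice_2 F \<noteq> {}"

definition basic_factor :: "'a semigrp \<Rightarrow> bool" where
  "basic_factor F \<longleftrightarrow> finite_simple_group F \<or> two_element_semilattice F"

end

theory Submission
  imports Defs "HOL-Algebra.Weak_Morphisms"
begin

text \<open>Block products, that is \<open>\<lambda>\<rho>\<close>-products over \<open>S\<close> with all index sets equal to \<open>S \<times> S\<close>,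
  \<open>\<lambda>[a,b] (u,v) = (u,bv)\<close> and \<open>\<rho>[a,b] (u,v) = (ua,v)\<close>, are monotone for division in both arguments,
  so it suffices to divide a semigroup, or the monoid obtained by adjoining a unit, into block
  products of smaller pieces. A group that is not simple embeds into a block product of a normal
  subgroup by the quotient. If a monoid \<open>M\<close> is not a group, choose a maximal proper
  submonoid \<open>N\<close> containing the units and some \<open>c \<notin> N\<close>. Every element of \<open>M\<close> then is a word in \<open>c\<close> and
  elements of \<open>N\<close>, and its part between the first and the last \<open>c\<close> is a product in the local
  divisor \<open>cM \<inter> Mc\<close>, which is smaller than \<open>M\<close> because \<open>c\<close> is not a unit. Hence \<open>M\<close> divides a block
  product of the local divisor by a semigroup built from \<open>N\<close> and the two-element semilattice.\<close>

section \<open>Division\<close>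

text \<open>\<open>R\<close> is the graph of a homomorphism from its domain, a subsemigroup of \<open>B\<close>, onto \<open>A\<close>.\<close>

definition division :: "('b \<Rightarrow> 'a \<Rightarrow> bool) \<Rightarrow> 'a semigrp \<Rightarrow> 'b semigrp \<Rightarrow> bool" where
  "division R A B \<longleftrightarrow>
     (\<forall>b a. R b a \<longrightarrow> b \<in> carrier B \<and> a \<in> carrier A) \<and>
     (\<forall>b a b' a'. R b a \<longrightarrow> R b' a' \<longrightarrow> R (b \<star>\<^bsub>B\<^esub> b') (a \<star>\<^bsub>A\<^esub> a')) \<and>
     (\<forall>b a a'. R b a \<longrightarrow> R b a' \<longrightarrow> a = a') \<and>
     (\<forall>a\<in>carrier A. \<exists>b. R b a)"

lemma divisionI:
  assumes "\<And>b a. R b a \<Longrightarrow> b \<in> carrier B \<and> a \<in> carrier A"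
    and "\<And>b a b' a'. R b a \<Longrightarrow> R b' a' \<Longrightarrow> R (b \<star>\<^bsub>B\<^esub> b') (a \<star>\<^bsub>A\<^esub> a')"
    and "\<And>b a a'. R b a \<Longrightarrow> R b a' \<Longrightarrow> a = a'"
    and "\<And>a. a \<in> carrier A \<Longrightarrow> \<exists>b. R b a"
  shows "division R A B"
  unfolding division_def using assms by blast

lemma divisionD:
  assumes "division R A B"
  shows "R b a \<Longrightarrow> b \<in> carrier B" "R b a \<Longrightarrow> a \<in> carrier A"
    and "R b a \<Longrightarrow> R b' a' \<Longrightarrow> R (b \<star>\<^bsub>B\<^esub> b') (a \<star>\<^bsub>A\<^esub> a')"
    and "R b a \<Longrightarrow> R b a' \<Longrightarrow> a = a'"
    and "a \<in> carrier A \<Longrightarrow> \<exists>b. R b a"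
  using assms unfolding division_def by blast+

text \<open>The homomorphism is recovered from its graph. Relations compose and combine pointwise
  without naming subsemigroups. Nonemptiness is stated apart because the empty relation is a
  division of an empty carrier.\<close>

lemma divides_iff_division: "divides A B \<longleftrightarrow> carrier A \<noteq> {} \<and> (\<exists>R. division R A B)"
proof
  assume "divides A B"
  then obtain T f where T: "subsemigrp T B" and f: "f \<in> semigrp_hom (B\<lparr>carrier := T\<rparr>) A"
    and onto: "f ` T = carrier A"
    unfolding divides_def by blast
  have "division (\<lambda>b a. b \<in> T \<and> f b = a) A B"
    by (rule divisionI) (use T f in \<open>auto simp: subsemigrp_def semigrp_hom_def onto[symmetric]\<close>)
  moreover have "carrier A \<noteq> {}"
    using T onto by (auto simp: subsemigrp_def)
  ultimately show "carrier A \<noteq> {} \<and> (\<exists>R. division R A B)" by blast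
next
  assume "carrier A \<noteq> {} \<and> (\<exists>R. division R A B)"
  then obtain R where ne: "carrier A \<noteq> {}" and R: "division R A B" by blast
  define T where "T = {b. \<exists>a. R b a}"
  define f where "f b = (THE a. R b a)" for b
  have f: "f b = a" if "R b a" for b a
    unfolding f_def using that divisionD(4)[OF R] by blast
  have "subsemigrp T B"
    using ne divisionD[OF R] unfolding subsemigrp_def T_def by blast
  moreover have "f \<in> semigrp_hom (B\<lparr>carrier := T\<rparr>) A"
    unfolding semigrp_hom_def T_def using f divisionD(2,3)[OF R] by auto
  moreover have "f ` T = carrier A"
    using f divisionD(2,5)[OF R] unfolding T_def by force
  ultimately show "divides A B" unfolding divides_def by blast
qed

lemma divides_trans:
  assumes "divides A B" "divides B C"
  shows "divides A C"
proof -
  obtain R Q where ne: "carrier A \<noteq> {}" and R: "division R A B" and Q: "division Q B C"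
    using assms unfolding divides_iff_division by blast
  have "division (\<lambda>c a. \<exists>b. Q c b \<and> R b a) A C"
  proof (rule divisionI)
    fix c a assume "\<exists>b. Q c b \<and> R b a"
    then show "c \<in> carrier C \<and> a \<in> carrier A" using divisionD[OF R] divisionD[OF Q] by blast
  next
    fix c a c' a' assume "\<exists>b. Q c b \<and> R b a" "\<exists>b. Q c' b \<and> R b a'"
    then show "\<exists>b. Q (c \<star>\<^bsub>C\<^esub> c') b \<and> R b (a \<star>\<^bsub>A\<^esub> a')"
      using divisionD(3)[OF R] divisionD(3)[OF Q] by blast
  next
    fix c a a' assume "\<exists>b. Q c b \<and> R b a" "\<exists>b. Q c b \<and> R b a'"
    then show "a = a'" using divisionD(4)[OF R] divisionD(4)[OF Q] by blast
  next
    fix a assume "a \<in> carrier A"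
    then show "\<exists>c b. Q c b \<and> R b a" 
      using divisionD(2,5)[OF R] divisionD(1,5)[OF Q] divisionD(1)[OF R] by meson
  qed
  with ne show ?thesis unfolding divides_iff_division by blast
qed

lemma divides_embedding:
  assumes "semigrp A" and hom: "f \<in> semigrp_hom A B" and inj: "inj_on f (carrier A)"
  shows "divides A B"
proof -
  interpret semigrp A by fact
  have "division (\<lambda>b a. a \<in> carrier A \<and> b = f a) A B"
    by (rule divisionI) (use hom inj closed in \<open>auto simp: semigrp_hom_def inj_on_def\<close>)
  then show ?thesis
    using nonempty unfolding divides_iff_division by blast
qed

lemma divides_iso:
  assumes "semigrp A" "f \<in> semigrp_iso A B"
  shows "divides A B"
  using assms by (intro divides_embedding) (auto simp: semigrp_iso_def bij_betw_def)

lemma semigrp_iso_image: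
  assumes A: "semigrp A" and f: "f \<in> semigrp_iso A B"
  shows "semigrp B"
proof -
  interpret semigrp A by fact
  have onto: "carrier B = f ` carrier A"
    using f by (auto simp: semigrp_iso_def bij_betw_def)
  have mult: "f x \<star>\<^bsub>B\<^esub> f y = f (x \<star>\<^bsub>A\<^esub> y)" if "x \<in> carrier A" "y \<in> carrier A" for x y
    using f that by (auto simp: semigrp_iso_def semigrp_hom_def)
  show ?thesis
    by standard (use nonempty closed assoc in \<open>auto simp: onto mult\<close>)
qed

section \<open>Block products\<close>

text \<open>A two-sided wreath product: \<open>x (u, v)\<close> is the contribution of an element
  standing between a left context \<open>u\<close> and a right context \<open>v\<close>. In a
  product the left factor sees \<open>b\<close> added to its right context, and the right factor
  sees \<open>a\<close> added to its left one.\<close>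

definition block_product :: "'h semigrp \<Rightarrow> 's semigrp \<Rightarrow> (('s \<times> 's \<Rightarrow> 'h) \<times> 's) semigrp" where
  "block_product H S = lr_product H S (\<lambda>_. carrier S \<times> carrier S)
     (\<lambda>a b (u, v). (u, b \<star>\<^bsub>S\<^esub> v)) (\<lambda>a b (u, v). (u \<star>\<^bsub>S\<^esub> a, v))"

lemma block_product_carrier:
  "(x, a) \<in> carrier (block_product H S) \<longleftrightarrow>
     a \<in> carrier S \<and> x \<in> carrier S \<times> carrier S \<rightarrow>\<^sub>E carrier H"
  by (simp add: block_product_def lr_product_def)

lemma block_product_mult:
  "(x, a) \<star>\<^bsub>block_product H S\<^esub> (y, b) =
     ((\<lambda>(u, v)\<in>carrier S \<times> carrier S. x (u, b \<star>\<^bsub>S\<^esub> v) \<star>\<^bsub>H\<^esub> y (u \<star>\<^bsub>S\<^esub> a, v)), a \<star>\<^bsub>S\<^esub> b)"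
  by (auto simp: block_product_def lr_product_def intro!: restrict_ext)

lemma block_product_lr_system:
  assumes "semigrp S"
  shows "lr_system S (\<lambda>_. carrier S \<times> carrier S)
     (\<lambda>a b (u, v). (u, b \<star>\<^bsub>S\<^esub> v)) (\<lambda>a b (u, v). (u \<star>\<^bsub>S\<^esub> a, v))"
proof -
  interpret semigrp S by fact
  show ?thesis by standard (auto simp: closed assoc)
qed

lemma semigrp_block_product:
  assumes "semigrp H" "semigrp S"
  shows "semigrp (block_product H S)"
  unfolding block_product_def by (intro lr_product_semigrp block_product_lr_system assms)

text \<open>A pair \<open>(g, s)\<close> covers \<open>(x, a)\<close> if \<open>s\<close> covers
  \<open>a\<close> and the value of \<open>g\<close> at contexts \<open>u\<close>, \<open>v\<close>
  covers the value of \<open>x\<close> at whatever \<open>u\<close> and \<open>v\<close> cover. This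
  relation is multiplicative because \<open>P\<close> and \<open>Q\<close> are, and single-valued
  because every context of \<open>S\<close> is covered.\<close>

lemma divides_block_product:
  assumes "divides H H'" "divides S S'" "semigrp H" "semigrp S" "semigrp H'" "semigrp S'"
  shows "divides (block_product H S) (block_product H' S')"
proof -
  interpret H: semigrp H by fact
  interpret S: semigrp S by fact
  interpret H': semigrp H' by fact
  interpret S': semigrp S' by fact
  obtain P Q where P: "division P H H'" and Q: "division Q S S'"
    using assms(1,2) unfolding divides_iff_division by blast
  define R where "R = (\<lambda>(g, s) (x, a). Q s a \<and>
      g \<in> carrier S' \<times> carrier S' \<rightarrow>\<^sub>E carrier H' \<and> x \<in> carrier S \<times> carrier S \<rightarrow>\<^sub>E carrier H \<and>
      (\<forall>u u' v v'. Q u u' \<longrightarrow> Q v v' \<longrightarrow> P (g (u, v)) (x (u', v'))))"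
  have R: "R (g, s) (x, a) \<longleftrightarrow> Q s a \<and>
      g \<in> carrier S' \<times> carrier S' \<rightarrow>\<^sub>E carrier H' \<and> x \<in> carrier S \<times> carrier S \<rightarrow>\<^sub>E carrier H \<and>
      (\<forall>u u' v v'. Q u u' \<longrightarrow> Q v v' \<longrightarrow> P (g (u, v)) (x (u', v')))" for g s x a
    unfolding R_def by simp
  have "division R (block_product H S) (block_product H' S')"
  proof (rule divisionI)
    fix b a assume "R b a"
    then show "b \<in> carrier (block_product H' S') \<and> a \<in> carrier (block_product H S)"
      using divisionD(1,2)[OF Q] by (cases b; cases a) (auto simp: R block_product_carrier)
  next
    fix b a b' a' assume as: "R b a" "R b' a'"
    obtain g s x c g' s' x' c' where e: "b = (g, s)" "a = (x, c)" "b' = (g', s')" "a' = (x', c')"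
      by (metis prod.exhaust)
    have m: "s \<in> carrier S'" "s' \<in> carrier S'" "c \<in> carrier S" "c' \<in> carrier S"
      using as divisionD(1,2)[OF Q] by (auto simp: e R)
    have c: "b \<star>\<^bsub>block_product H' S'\<^esub> b' \<in> carrier (block_product H' S')"
         "a \<star>\<^bsub>block_product H S\<^esub> a' \<in> carrier (block_product H S)"
      by (rule semigrp.closed, rule semigrp_block_product; use as m assms in \<open>auto simp: e R block_product_carrier\<close>)+
    show "R (b \<star>\<^bsub>block_product H' S'\<^esub> b') (a \<star>\<^bsub>block_product H S\<^esub> a')"
      unfolding e block_product_mult R
    proof (intro conjI allI impI)
      show "Q (s \<star>\<^bsub>S'\<^esub> s') (c \<star>\<^bsub>S\<^esub> c')"
        using as by (auto simp: e R intro: divisionD(3)[OF Q])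
      fix u u' v v' assume uv: "Q u u'" "Q v v'"
      have "Q (s' \<star>\<^bsub>S'\<^esub> v) (c' \<star>\<^bsub>S\<^esub> v')" "Q (u \<star>\<^bsub>S'\<^esub> s) (u' \<star>\<^bsub>S\<^esub> c)"
        using as uv by (auto simp: e R intro: divisionD(3)[OF Q])
      then have "P (g (u, s' \<star>\<^bsub>S'\<^esub> v)) (x (u', c' \<star>\<^bsub>S\<^esub> v'))" "P (g' (u \<star>\<^bsub>S'\<^esub> s, v)) (x' (u' \<star>\<^bsub>S\<^esub> c, v'))"
        using as uv by (simp_all add: e R)
      then show "P ((\<lambda>(u, v)\<in>carrier S' \<times> carrier S'. g (u, s' \<star>\<^bsub>S'\<^esub> v) \<star>\<^bsub>H'\<^esub> g' (u \<star>\<^bsub>S'\<^esub> s, v)) (u, v))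
          ((\<lambda>(u, v)\<in>carrier S \<times> carrier S. x (u, c' \<star>\<^bsub>S\<^esub> v) \<star>\<^bsub>H\<^esub> x' (u \<star>\<^bsub>S\<^esub> c, v)) (u', v'))"
        using divisionD(1,2)[OF Q] uv by (simp add: divisionD(3)[OF P])
    qed (use c in \<open>simp_all only: e block_product_mult block_product_carrier\<close>)
  next
    fix b a a' assume as: "R b a" "R b a'"
    obtain g s x c x' c' where e: "b = (g, s)" "a = (x, c)" "a' = (x', c')"
      by (metis prod.exhaust)
    have "x = x'"
    proof (rule PiE_ext)
      show "x \<in> carrier S \<times> carrier S \<rightarrow>\<^sub>E carrier H" "x' \<in> carrier S \<times> carrier S \<rightarrow>\<^sub>E carrier H"
        using as by (auto simp: e R)
      fix i assume "i \<in> carrier S \<times> carrier S"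
      then obtain u v where uv: "i = (u, v)" "u \<in> carrier S" "v \<in> carrier S" by blast
      obtain u' v' where "Q u' u" "Q v' v" using uv divisionD(5)[OF Q] by meson
      then have "P (g (u', v')) (x i)" "P (g (u', v')) (x' i)" using as unfolding e R uv by blast+
      then show "x i = x' i" by (rule divisionD(4)[OF P])
    qed
    moreover have "c = c'" using as divisionD(4)[OF Q] by (auto simp: e R)
    ultimately show "a = a'" by (simp add: e)
  next
    fix a assume as: "a \<in> carrier (block_product H S)"
    obtain x c where a: "a = (x, c)" by (metis prod.exhaust)
    have x: "c \<in> carrier S" "x \<in> carrier S \<times> carrier S \<rightarrow>\<^sub>E carrier H"
      using as by (auto simp: a block_product_carrier)
    obtain s where s: "Q s c" using x divisionD(5)[OF Q] by blast
    \<comment> \<open>As \<open>u\<close> and \<open>v\<close> determine what they cover, each pair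
      of contexts prescribes at most one value to be covered; where it prescribes none, any element
      of \<open>H'\<close> will do.\<close>
    define G where "G = (\<lambda>(u, v) h. h \<in> carrier H' \<and>
       (\<forall>u' v'. Q u u' \<longrightarrow> Q v v' \<longrightarrow> P h (x (u', v'))))"
    have ex: "\<exists>h. G i h" if "i \<in> carrier S' \<times> carrier S'" for i
    proof -
      obtain u v where i: "i = (u, v)" by (metis prod.exhaust)
      show ?thesis
      proof (cases "\<exists>u' v'. Q u u' \<and> Q v v'")
        case True
        then obtain u' v' where q: "Q u u'" "Q v v'" by blast
        then have "x (u', v') \<in> carrier H"
          using x divisionD(2)[OF Q] by (auto simp: PiE_iff)
        then obtain h where h: "P h (x (u', v'))" using divisionD(5)[OF P] by blast
        have "P h (x (p, q))" if "Q u p" "Q v q" for p q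
          using h divisionD(4)[OF Q that(1) \<open>Q u u'\<close>] divisionD(4)[OF Q that(2) \<open>Q v v'\<close>] by simp
        then show ?thesis unfolding G_def i using divisionD(1)[OF P h] by auto
      next
        case False
        then show ?thesis unfolding G_def i using H'.nonempty by auto
      qed
    qed
    define g where "g = (\<lambda>i\<in>carrier S' \<times> carrier S'. SOME h. G i h)"
    have g: "G i (g i)" if "i \<in> carrier S' \<times> carrier S'" for i
      unfolding g_def using someI_ex[OF ex[OF that]] that by simp
    have "R (g, s) a"
      unfolding a R
    proof (intro conjI allI impI)
      show "g \<in> carrier S' \<times> carrier S' \<rightarrow>\<^sub>E carrier H'"
        using g unfolding G_def by (auto simp: PiE_iff g_def)
      fix u u' v v' assume "Q u u'" "Q v v'"
      then show "P (g (u, v)) (x (u', v'))"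
        using g[of "(u, v)"] divisionD(1)[OF Q] unfolding G_def by auto
    qed (use s x in auto)
    then show "\<exists>b. R b a" by blast
  qed
  then show ?thesis
    using semigrp.nonempty[OF semigrp_block_product[OF assms(3,4)]]
    unfolding divides_iff_division by blast
qed

text \<open>Index sets of a product on \<open>nat elem\<close> consist of numbers, so the pairs of
  contexts are numbered by \<open>e\<close>, which exists as \<open>S\<close> is finite, and decoded
  by \<open>d\<close>. Reading functions through this numbering embeds the block product.\<close>

lemma block_product_divides_elem_lr_product:
  fixes H S :: "nat elem semigrp"
  assumes H: "semigrp H" "finite (carrier H)" and S: "semigrp S" "finite (carrier S)"
  obtains I :: "nat elem \<Rightarrow> nat set" and l r where "lr_system S I l r"
    "finite (carrier (elem_lr_product H S I l r))"
    "divides (block_product H S) (elem_lr_product H S I l r)"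
proof -
  interpret S: semigrp S by fact
  interpret H: semigrp H by fact
  let ?D = "carrier S \<times> carrier S"
  obtain e :: "nat elem \<times> nat elem \<Rightarrow> nat" where e: "inj_on e ?D"
    using S(2) finite_imp_inj_to_nat_seg[of ?D] by blast
  define d where "d = inv_into ?D e"
  have de: "d (e (u, v)) = (u, v)" if "u \<in> carrier S" "v \<in> carrier S" for u v
    unfolding d_def using inv_into_f_f[OF e] that by simp
  define I where "I = (\<lambda>_ :: nat elem. e ` ?D)"
  define l where "l = (\<lambda>(a :: nat elem) b i. e (fst (d i), b \<star>\<^bsub>S\<^esub> snd (d i)))"
  define r where "r = (\<lambda>a (b :: nat elem) i. e (fst (d i) \<star>\<^bsub>S\<^esub> a, snd (d i)))"
  have sys: "lr_system S I l r"
    by standard (auto simp: I_def l_def r_def de S.closed S.assoc)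
  have fin: "finite (carrier (lr_product H S I l r))"
  proof (rule finite_subset)
    show "carrier (lr_product H S I l r) \<subseteq> (e ` ?D \<rightarrow>\<^sub>E carrier H) \<times> carrier S"
      by (auto simp: lr_product_def I_def)
    show "finite ((e ` ?D \<rightarrow>\<^sub>E carrier H) \<times> carrier S)"
      using H S by (intro finite_cartesian_product finite_PiE) auto
  qed
  define h where "h = (\<lambda>(x :: nat elem \<times> nat elem \<Rightarrow> nat elem, a :: nat elem). (\<lambda>i\<in>e ` ?D. x (d i), a))"
  have "h \<in> semigrp_hom (block_product H S) (lr_product H S I l r)"
  proof -
    have "h (x, a) \<in> carrier (lr_product H S I l r)" if "(x, a) \<in> carrier (block_product H S)" for x a
      using that by (auto simp: h_def lr_product_def block_product_carrier I_def de PiE_iff)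
    moreover have "h ((x, a) \<star>\<^bsub>block_product H S\<^esub> (y, b)) = h (x, a) \<star>\<^bsub>lr_product H S I l r\<^esub> h (y, b)"
      if "(x, a) \<in> carrier (block_product H S)" "(y, b) \<in> carrier (block_product H S)" for x a y b
      using that
      by (auto simp: block_product_mult h_def lr_product_def block_product_carrier I_def de l_def r_def S.closed
          intro!: restrict_ext)
    ultimately show ?thesis by (auto simp: semigrp_hom_def)
  qed
  moreover have "inj_on h (carrier (block_product H S))"
  proof (rule inj_onI)
    fix p q assume as: "p \<in> carrier (block_product H S)" "q \<in> carrier (block_product H S)" "h p = h q"
    obtain x a y b where pq: "p = (x, a)" "q = (y, b)" by (metis prod.exhaust)
    have "x = y"
    proof (rule PiE_ext)
      show "x \<in> ?D \<rightarrow>\<^sub>E carrier H" "y \<in> ?D \<rightarrow>\<^sub>E carrier H"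
        using as by (auto simp: pq block_product_carrier)
      fix i assume i: "i \<in> ?D"
      have "(\<lambda>i\<in>e ` ?D. x (d i)) (e i) = (\<lambda>i\<in>e ` ?D. y (d i)) (e i)"
        using as(3) by (simp add: pq h_def)
      then show "x i = y i" using i by (cases i) (simp add: de)
    qed
    then show "p = q" using as(3) by (simp add: pq h_def)
  qed
  ultimately have "divides (block_product H S) (lr_product H S I l r)"
    by (rule divides_embedding[OF semigrp_block_product[OF H(1) S(1)]])
  moreover have "divides (lr_product H S I l r) (elem_lr_product H S I l r)"
    by (rule divides_iso[OF lr_product_semigrp elem_lr_product_iso]) (use H sys in auto)
  ultimately have "divides (block_product H S) (elem_lr_product H S I l r)"
    by (rule divides_trans)
  moreover have "finite (carrier (elem_lr_product H S I l r))"
    using fin by (simp add: elem_lr_product_def transport_def)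
  ultimately show ?thesis using sys that by blast
qed

section \<open>Decomposable semigroups\<close>

text \<open>Only the witness \<open>B\<close> lives on \<open>nat elem\<close>; \<open>A\<close> may
  have any type, so block products can be formed freely. The witness is kept a finite semigroup so
  that the contexts of further block products over it can be numbered.\<close>

definition decomposable :: "'a semigrp \<Rightarrow> bool" where
  "decomposable A \<longleftrightarrow> (\<exists>B :: nat elem semigrp. iterated_lr_product basic_factor B \<and>
     semigrp B \<and> finite (carrier B) \<and> divides A B)"

lemma decomposable_divides: "divides A B \<Longrightarrow> decomposable B \<Longrightarrow> decomposable A"
  unfolding decomposable_def using divides_trans by blast

text \<open>By monotonicity both arguments may be replaced by their witnesses on
  \<open>nat elem\<close>, whose block product divides one more
  \<open>\<lambda>\<rho>\<close>-product there.\<close>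

lemma decomposable_block_product:
  assumes "decomposable H" "decomposable S" "semigrp H" "semigrp S"
  shows "decomposable (block_product H S)"
proof -
  obtain H' S' :: "nat elem semigrp"
    where H: "iterated_lr_product basic_factor H'" "semigrp H'" "finite (carrier H')" "divides H H'"
      and S: "iterated_lr_product basic_factor S'" "semigrp S'" "finite (carrier S')" "divides S S'"
    using assms(1,2) unfolding decomposable_def by blast
  obtain I :: "nat elem \<Rightarrow> nat set" and l r where B: "lr_system S' I l r"
    "finite (carrier (elem_lr_product H' S' I l r))"
    "divides (block_product H' S') (elem_lr_product H' S' I l r)"
    using block_product_divides_elem_lr_product[OF H(2,3) S(2,3)] by blast
  have "iterated_lr_product basic_factor (elem_lr_product H' S' I l r)"
    by (rule product[OF H(1) S(1) B(1)])
  moreover have "semigrp (elem_lr_product H' S' I l r)"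
    by (rule semigrp_iso_image[OF lr_product_semigrp elem_lr_product_iso]) (use H B in auto)
  moreover have "divides (block_product H S) (elem_lr_product H' S' I l r)"
    by (rule divides_trans[OF divides_block_product B(3)]) (use assms H S in auto)
  ultimately show ?thesis unfolding decomposable_def using B(2) by blast
qed

lemma semigrp_join_semilattice_2: "semigrp join_semilattice_2"
  by standard (auto simp: join_semilattice_2_def)

lemma decomposable_join_semilattice_2: "decomposable join_semilattice_2"
proof -
  define f :: "bool \<Rightarrow> nat elem" where "f b = Atom (if b then 1 else 0)" for b
  have iso: "f \<in> semigrp_iso join_semilattice_2 (transport f join_semilattice_2)"
    by (rule transport_iso[OF semigrp_join_semilattice_2]) (auto simp: inj_on_def f_def split: if_splits)
  then have "basic_factor (transport f join_semilattice_2)"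
    unfolding basic_factor_def two_element_semilattice_def by blast
  moreover have "finite (carrier (transport f join_semilattice_2))"
    by (simp add: transport_def)
  ultimately show ?thesis
    unfolding decomposable_def
    using divides_iso[OF semigrp_join_semilattice_2 iso] semigrp_iso_image[OF semigrp_join_semilattice_2 iso]
    by (blast intro: factor)
qed

text \<open>The idempotent \<open>False\<close> of the semilattice is a copy of the one-element
  semigroup. This supplies the trivial group, which does not count as simple.\<close>

lemma decomposable_singleton:
  assumes "semigrp A" "carrier A = {e}"
  shows "decomposable A"
proof -
  have "e \<star>\<^bsub>A\<^esub> e = e" using semigrp.closed[OF assms(1)] assms(2) by auto
  then have "division (\<lambda>b a. a = e \<and> b = False) A join_semilattice_2"
    using assms by (intro divisionI) (auto simp: join_semilattice_2_def)
  then have "divides A join_semilattice_2" using assms(2) unfolding divides_iff_division by blast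
  then show ?thesis by (rule decomposable_divides[OF _ decomposable_join_semilattice_2])
qed

definition semigrp_of :: "('a, 'b) monoid_scheme \<Rightarrow> 'a semigrp" where
  "semigrp_of G = \<lparr>carrier = carrier G, sgmult = monoid.mult G\<rparr>"

lemma semigrp_of_simps [simp]:
  "carrier (semigrp_of G) = carrier G" "x \<star>\<^bsub>semigrp_of G\<^esub> y = x \<otimes>\<^bsub>G\<^esub> y"
  by (simp_all add: semigrp_of_def)

lemma (in monoid) semigrp_semigrp_of: "semigrp (semigrp_of G)"
  by standard (auto simp: m_assoc)

section \<open>Groups\<close>

text \<open>The Kaloujnine--Krasner embedding of an extension into the wreath product of its ends.\<close>

lemma (in group) decomposable_extension:
  fixes f :: "'a \<Rightarrow> 'c"
  assumes f: "weak_group_morphism f H G"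
    and H: "decomposable (semigrp_of (G\<lparr>carrier := H\<rparr>))"
    and Q: "decomposable (semigrp_of (image_group f G))"
  shows "decomposable (semigrp_of G)"
proof -
  define Q where "Q = image_group f G"
  interpret Q: group Q unfolding Q_def by (rule image_group_is_group[OF f])
  have HG: "H \<lhd> G" using f by (rule weak_group_morphism.axioms(1))
  then interpret N: normal H G .
  have f_eq: "f a = f b \<longleftrightarrow> a \<otimes> inv b \<in> H" if "a \<in> carrier G" "b \<in> carrier G" for a b
    using weak_group_morphism.inj_mod_subgroup[OF f that] .
  have carrQ: "carrier Q = f ` carrier G" unfolding Q_def image_group_def by simp
  have hom: "f (a \<otimes> b) = f a \<otimes>\<^bsub>Q\<^esub> f b" if "a \<in> carrier G" "b \<in> carrier G" for a b
    using weak_group_morphism_is_hom[OF f] that unfolding Q_def by (auto simp: hom_def)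
  define t where "t = inv_into (carrier G) f"
  have t: "t u \<in> carrier G" "f (t u) = u" if "u \<in> carrier Q" for u
    using that unfolding carrQ t_def by (auto intro: inv_into_into f_inv_into_f)
  have fQ: "f g \<in> carrier Q" if "g \<in> carrier G" for g using that carrQ by blast
  let ?H = "G\<lparr>carrier := H\<rparr>"
  \<comment> \<open>With \<open>t\<close> a section of \<open>f\<close>, the value at the left
    context \<open>u\<close> is the element of \<open>H\<close> by which
    \<open>t u \<otimes> g\<close> differs from the chosen preimage of its image in the
    quotient.\<close>
  define \<phi> where "\<phi> g = (\<lambda>(u, v)\<in>carrier Q \<times> carrier Q. t u \<otimes> g \<otimes> inv (t (u \<otimes>\<^bsub>Q\<^esub> f g)), f g)" for g
  have mem: "t u \<otimes> g \<otimes> inv (t (u \<otimes>\<^bsub>Q\<^esub> f g)) \<in> H" if "u \<in> carrier Q" "g \<in> carrier G" for u g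
    using that by (subst f_eq[symmetric]) (auto simp: t hom fQ)
  let ?B = "block_product (semigrp_of ?H) (semigrp_of Q)"
  \<comment> \<open>The values telescope: the representative that ends the first cancels the one
    that begins the second.\<close>
  have cocycle: "t u \<otimes> g \<otimes> inv (t (u \<otimes>\<^bsub>Q\<^esub> f g)) \<otimes>
        (t (u \<otimes>\<^bsub>Q\<^esub> f g) \<otimes> g' \<otimes> inv (t (u \<otimes>\<^bsub>Q\<^esub> f g \<otimes>\<^bsub>Q\<^esub> f g')))
      = t u \<otimes> (g \<otimes> g') \<otimes> inv (t (u \<otimes>\<^bsub>Q\<^esub> f (g \<otimes> g')))"
    if g: "g \<in> carrier G" "g' \<in> carrier G" and u: "u \<in> carrier Q" for g g' u
  proof -
    have "inv (t (u \<otimes>\<^bsub>Q\<^esub> f g)) \<otimes> (t (u \<otimes>\<^bsub>Q\<^esub> f g) \<otimes> y) = y" if "y \<in> carrier G" for y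
      using that u g fQ t by (simp add: m_assoc[symmetric])
    then show ?thesis using u g fQ t by (simp add: m_assoc Q.m_assoc hom)
  qed
  have "divides (semigrp_of G) ?B"
  proof (rule divides_embedding[OF semigrp_semigrp_of])
    have "\<phi> (g \<otimes> g') = \<phi> g \<star>\<^bsub>?B\<^esub> \<phi> g'" if "g \<in> carrier G" "g' \<in> carrier G" for g g'
      using that fQ by (auto simp: \<phi>_def block_product_mult hom cocycle intro!: restrict_ext)
    moreover have "\<phi> g \<in> carrier ?B" if "g \<in> carrier G" for g
      using that by (auto simp: \<phi>_def block_product_carrier mem fQ)
    ultimately show "\<phi> \<in> semigrp_hom (semigrp_of G) ?B" by (simp add: semigrp_hom_def)
    show "inj_on \<phi> (carrier (semigrp_of G))"
    proof (rule inj_onI)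
      fix g g' assume g: "g \<in> carrier (semigrp_of G)" "g' \<in> carrier (semigrp_of G)" and e: "\<phi> g = \<phi> g'"
      \<comment> \<open>Equal images give equal representatives on both sides of \<open>g\<close>
        and \<open>g'\<close> at the unit context, so these can be cancelled.\<close>
      have "f g = f g'" using e by (simp add: \<phi>_def)
      moreover have "fst (\<phi> g) (\<one>\<^bsub>Q\<^esub>, \<one>\<^bsub>Q\<^esub>) = fst (\<phi> g') (\<one>\<^bsub>Q\<^esub>, \<one>\<^bsub>Q\<^esub>)" using e by simp
      ultimately show "g = g'" using g t fQ by (simp add: \<phi>_def)
    qed
  qed
  then show ?thesis
    by (rule decomposable_divides)
      (intro decomposable_block_product H Q[folded Q_def] Q.semigrp_semigrp_of
        monoid.semigrp_semigrp_of group.is_monoid N.subgroup_is_group is_group)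
qed

text \<open>A normal subgroup other than \<open>{\<one>}\<close> and the whole group splits
  \<open>G\<close> into two smaller groups. The quotient is carried by chosen coset representatives
  rather than by cosets, so that it has the type of \<open>G\<close> and an induction over groups of
  one type can proceed.\<close>

lemma exists_proper_normal_quotient:
  fixes G :: "'a monoid" (structure)
  assumes "group G" "finite (carrier G)" "\<not> simple_group G" "order G > 1"
  obtains H and f :: "'a \<Rightarrow> 'a" where "weak_group_morphism f H G" "card H < order G"
    "card (f ` carrier G) < order G"
proof -
  interpret group G by fact
  obtain H where H: "H \<lhd> G" "H \<noteq> carrier G" "H \<noteq> {\<one>}"
    using assms(3,4) is_group unfolding simple_group_def simple_group_axioms_def by blast
  interpret normal H G by fact
  define f where "f a = (SOME x. x \<in> H #> a)" for a
  have rep: "f a \<in> H #> a" if "a \<in> carrier G" for a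
    unfolding f_def using rcos_self[OF that is_subgroup] by (rule someI)
  have "f a = f b \<longleftrightarrow> a \<otimes> inv b \<in> H" if ab: "a \<in> carrier G" "b \<in> carrier G" for a b
  proof -
    have "f a = f b \<longleftrightarrow> H #> a = H #> b"
    proof
      assume "f a = f b"
      then show "H #> a = H #> b"
        using repr_independence[OF rep[OF ab(1)] ab(1) is_subgroup]
          repr_independence[OF rep[OF ab(2)] ab(2) is_subgroup] by simp
    qed (simp add: f_def)
    also have "\<dots> \<longleftrightarrow> H #> (a \<otimes> inv b) = H"
      using coset_mult_inv1[OF _ ab subset] coset_mult_inv2[OF _ ab subset] by blast
    also have "\<dots> \<longleftrightarrow> a \<otimes> inv b \<in> H"
      using coset_join1[OF _ _ is_subgroup, of "a \<otimes> inv b"]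
        coset_join2[OF _ is_subgroup, of "a \<otimes> inv b"] ab by auto
    finally show ?thesis .
  qed
  then have wf: "weak_group_morphism f H G" by (rule weak_group_morphismsI[OF H(1)])
  have "card H < order G"
    unfolding order_def using H(2) subset by (intro psubset_card_mono assms) auto
  moreover have "card (f ` carrier G) < order G"
  proof -
    \<comment> \<open>Some \<open>h\<close> other than the unit is identified with the unit, so the
      quotient is strictly smaller.\<close>
    obtain h where h: "h \<in> H" "h \<noteq> \<one>" using H(3) one_closed by blast
    then have "f h = f \<one>" using weak_group_morphism.inj_mod_subgroup[OF wf] by auto
    then have "\<not> inj_on f (carrier G)" using h subset by (auto simp: inj_on_def)
    then show ?thesis
      unfolding order_def using card_image_le[OF assms(2), of f] eq_card_imp_inj_on[OF assms(2), of f]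
      by linarith
  qed
  ultimately show ?thesis using wf that by blast
qed

text \<open>Induction on the order: simple groups are factors themselves, and other nontrivial
  groups are extensions of smaller ones. The type is \<open>nat elem\<close> because the factors of
  an iterated product on \<open>nat elem\<close> have to lie there.\<close>

lemma decomposable_elem_group:
  fixes G :: "nat elem monoid"
  assumes "group G" "finite (carrier G)"
  shows "decomposable (semigrp_of G)"
  using assms
proof (induction "order G" arbitrary: G rule: less_induct)
  case less
  interpret group G by fact
  show ?case
  proof (cases "simple_group G")
    case True
    then have "basic_factor (semigrp_of G)"
      unfolding basic_factor_def finite_simple_group_def semigrp_of_def using less.prems by blast
    moreover have "id \<in> semigrp_iso (semigrp_of G) (semigrp_of G)"
      by (auto simp: semigrp_iso_def semigrp_hom_def)
    ultimately show ?thesis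
      unfolding decomposable_def using divides_iso semigrp_semigrp_of less.prems(2)
      by (metis factor semigrp_of_simps(1))
  next
    case nonsimple: False
    show ?thesis
    proof (cases "order G > 1")
      case True
      obtain H and f :: "nat elem \<Rightarrow> nat elem"
        where f: "weak_group_morphism f H G" "card H < order G" "card (f ` carrier G) < order G"
        using exists_proper_normal_quotient[OF less.prems nonsimple True] .
      interpret normal H G using f(1) by (rule weak_group_morphism.axioms(1))
      show ?thesis
      proof (rule decomposable_extension[OF f(1)]; rule less.hyps)
        show "group (G\<lparr>carrier := H\<rparr>)" by (rule subgroup_is_group[OF is_group])
        show "group (image_group f G)" by (rule image_group_is_group[OF f(1)])
        show "finite (carrier (G\<lparr>carrier := H\<rparr>))"
          using finite_subset[OF subset less.prems(2)] by simp
      qed (use f less.prems in \<open>simp_all add: order_def image_group_def\<close>)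
    next
      case False
      then have "order G = 1" using order_gt_0_iff_finite less.prems(2) by linarith
      then have "carrier (semigrp_of G) = {\<one>\<^bsub>G\<^esub>}"
        using order_one_triv_iff by simp
      then show ?thesis by (rule decomposable_singleton[OF semigrp_semigrp_of])
    qed
  qed
qed

text \<open>Numbering the carrier by atoms is injective, hence a weak morphism with trivial kernel,
  and its image group is a copy of \<open>G\<close> on \<open>nat elem\<close>.\<close>

lemma decomposable_group:
  fixes G :: "'a monoid" (structure)
  assumes "group G" "finite (carrier G)"
  shows "decomposable (semigrp_of G)"
proof -
  interpret group G by fact
  obtain n :: "'a \<Rightarrow> nat" where n: "inj_on n (carrier G)"
    using assms(2) finite_imp_inj_to_nat_seg by blast
  define f :: "'a \<Rightarrow> nat elem" where "f = Atom \<circ> n"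
  have inj: "inj_on f (carrier G)" using n by (auto simp: f_def inj_on_def)
  have "f a = f b \<longleftrightarrow> a \<otimes> inv b \<in> {\<one>}" if "a \<in> carrier G" "b \<in> carrier G" for a b
    using that inj_onD[OF inj] by (auto simp: inv_equality inv_solve_right')
  then have f: "weak_group_morphism f {\<one>} G"
    by (rule weak_group_morphismsI[OF one_is_normal])
  have "decomposable (semigrp_of (image_group f G))"
    using image_group_is_group[OF f] assms(2)
    by (intro decomposable_elem_group) (simp_all add: image_group_def)
  moreover have "f \<in> semigrp_iso (semigrp_of G) (semigrp_of (image_group f G))"
    using inj by (auto simp: semigrp_iso_def semigrp_hom_def bij_betw_def image_group_def)
  ultimately show ?thesis
    using decomposable_divides divides_iso[OF semigrp_semigrp_of] by blast
qed

section \<open>Monoids\<close>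

text \<open>Words over \<open>N\<close> and a marker, of which only the ends are kept: the flag
  tells whether a marker occurs, \<open>p\<close> is the block before the first marker and
  \<open>q\<close> the block after the last one. Blocks caught between markers are lost in a
  product. A marker-free word \<open>n\<close> will be represented by \<open>(False, n, n)\<close>,
  as it can be extended at either end.\<close>

definition two_ended :: "('a, 'b) monoid_scheme \<Rightarrow> (bool \<times> 'a \<times> 'a) monoid" where
  "two_ended N = \<lparr>carrier = UNIV \<times> carrier N \<times> carrier N,
     monoid.mult = (\<lambda>(f, p, q) (f', p', q').
       (f \<or> f', if f then p else p \<otimes>\<^bsub>N\<^esub> p', if f' then q' else q \<otimes>\<^bsub>N\<^esub> q')),
     one = (False, \<one>\<^bsub>N\<^esub>, \<one>\<^bsub>N\<^esub>)\<rparr>"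

lemma (in monoid) monoid_two_ended: "monoid (two_ended G)"
  by standard (auto simp: two_ended_def m_assoc)

text \<open>The semilattice records whether a marker occurs to the left (\<open>u\<close>) or to the
  right (\<open>v\<close>). The value of \<open>e\<close> is the part of the word not enclosed by
  markers in that context: \<open>q\<close> if markers stand only on the left, \<open>p\<close> if
  only on the right, nothing if on both sides. The two one-sided contexts give back \<open>q\<close>
  and \<open>p\<close>, whence injectivity.\<close>

lemma (in monoid) decomposable_two_ended:
  assumes "decomposable (semigrp_of G)"
  shows "decomposable (semigrp_of (two_ended G))"
proof -
  let ?B = "block_product (semigrp_of G) join_semilattice_2"
  define e where "e = (\<lambda>(f, p, q) (u, v).
    if u \<and> v then \<one> else if u then q else if v then p else if f then p \<otimes> q else p)"
  define \<phi> where "\<phi> a = (e a, fst a)" for a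
  have e_mult: "e a (u, fst a' \<or> v) \<otimes> e a' (u \<or> fst a, v) = e (a \<otimes>\<^bsub>two_ended G\<^esub> a') (u, v)"
    if "a \<in> carrier (two_ended G)" "a' \<in> carrier (two_ended G)" for a a' u v
  proof -
    obtain f p q f' p' q' where "a = (f, p, q)" "a' = (f', p', q')" by (metis prod.exhaust)
    then show ?thesis
      using that by (cases f; cases f'; cases u; cases v) (simp_all add: e_def two_ended_def m_assoc)
  qed
  have "divides (semigrp_of (two_ended G)) ?B"
  proof (rule divides_embedding)
    show "semigrp (semigrp_of (two_ended G))"
      by (rule monoid.semigrp_semigrp_of[OF monoid_two_ended])
    have "\<phi> a \<in> carrier ?B" if "a \<in> carrier (two_ended G)" for a
      using that by (cases a)
        (auto simp: \<phi>_def e_def two_ended_def block_product_carrier join_semilattice_2_def PiE_UNIV_domain)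
    moreover have "\<phi> (a \<otimes>\<^bsub>two_ended G\<^esub> a') = \<phi> a \<star>\<^bsub>?B\<^esub> \<phi> a'"
      if "a \<in> carrier (two_ended G)" "a' \<in> carrier (two_ended G)" for a a'
      using that
      by (auto simp: \<phi>_def block_product_mult e_mult join_semilattice_2_def two_ended_def
          restrict_UNIV)
    ultimately show "\<phi> \<in> semigrp_hom (semigrp_of (two_ended G)) ?B"
      by (simp add: semigrp_hom_def)
    show "inj_on \<phi> (carrier (semigrp_of (two_ended G)))"
    proof (rule inj_onI)
      fix a a' assume "\<phi> a = \<phi> a'"
      then have "e a (True, False) = e a' (True, False)" "e a (False, True) = e a' (False, True)"
        "fst a = fst a'" by (simp_all add: \<phi>_def)
      then show "a = a'" by (cases a; cases a') (simp add: e_def)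
    qed
  qed
  then show ?thesis
    by (rule decomposable_divides)
      (intro decomposable_block_product assms decomposable_join_semilattice_2
        semigrp_semigrp_of semigrp_join_semilattice_2)
qed

section \<open>Local divisors\<close>

text \<open>The local divisor has universe \<open>cM \<inter> Mc\<close> and product \<open>zc \<circ> cy = zcy\<close>, which does not depend
  on the \<open>z\<close> chosen by \<open>SOME\<close>.\<close>

definition local_divisor :: "('a, 'b) monoid_scheme \<Rightarrow> 'a \<Rightarrow> 'a monoid" where
  "local_divisor M c = \<lparr>carrier = {x. (\<exists>y\<in>carrier M. x = c \<otimes>\<^bsub>M\<^esub> y) \<and> (\<exists>y\<in>carrier M. x = y \<otimes>\<^bsub>M\<^esub> c)},
     monoid.mult = (\<lambda>x y. (SOME z. z \<in> carrier M \<and> x = z \<otimes>\<^bsub>M\<^esub> c) \<otimes>\<^bsub>M\<^esub> y), one = c\<rparr>"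

context monoid
begin

lemma local_divisor_memD:
  assumes "x \<in> carrier (local_divisor G c)"
  obtains y z where "y \<in> carrier G" "x = c \<otimes> y" "z \<in> carrier G" "x = z \<otimes> c"
  using assms unfolding local_divisor_def by auto

lemma local_divisor_memI:
  "y \<in> carrier G \<Longrightarrow> z \<in> carrier G \<Longrightarrow> x = c \<otimes> y \<Longrightarrow> x = z \<otimes> c \<Longrightarrow> x \<in> carrier (local_divisor G c)"
  unfolding local_divisor_def partial_object.select_convs mem_Collect_eq by blast

lemma local_divisor_mult:
  assumes c: "c \<in> carrier G" and "z \<in> carrier G" "y \<in> carrier G"
  shows "(z \<otimes> c) \<otimes>\<^bsub>local_divisor G c\<^esub> (c \<otimes> y) = z \<otimes> c \<otimes> y"
proof -
  define w where "w = (SOME w. w \<in> carrier G \<and> z \<otimes> c = w \<otimes> c)"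
  have "w \<in> carrier G \<and> z \<otimes> c = w \<otimes> c"
    unfolding w_def by (rule someI[of _ z]) (use assms in simp)
  then have w: "w \<in> carrier G" "w \<otimes> c = z \<otimes> c" by simp_all
  have "(z \<otimes> c) \<otimes>\<^bsub>local_divisor G c\<^esub> (c \<otimes> y) = w \<otimes> (c \<otimes> y)"
    by (simp add: local_divisor_def w_def)
  also have "\<dots> = z \<otimes> c \<otimes> y" using assms w by (simp add: m_assoc[symmetric])
  finally show ?thesis .
qed

lemma local_divisor_one [simp]: "\<one>\<^bsub>local_divisor G c\<^esub> = c"
  by (simp add: local_divisor_def)

lemma local_divisor_subset: "c \<in> carrier G \<Longrightarrow> carrier (local_divisor G c) \<subseteq> carrier G"
  unfolding local_divisor_def by auto

text \<open>Every element has two forms, \<open>x = c x1 = x2 c\<close>. The product of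
  \<open>x\<close> and \<open>y\<close> is \<open>x2 c y1 = c x1 y1 = x2 y2 c\<close>, which again
  has both forms, and both bracketings of three elements give \<open>x2 c y1 z1\<close>.\<close>

lemma monoid_local_divisor:
  assumes c: "c \<in> carrier G"
  shows "monoid (local_divisor G c)"
proof
  fix x y assume x: "x \<in> carrier (local_divisor G c)" and y: "y \<in> carrier (local_divisor G c)"
  obtain x1 x2 where x1: "x1 \<in> carrier G" "x = c \<otimes> x1" and x2: "x2 \<in> carrier G" "x = x2 \<otimes> c"
    using x by (rule local_divisor_memD)
  obtain y1 y2 where y1: "y1 \<in> carrier G" "y = c \<otimes> y1" and y2: "y2 \<in> carrier G" "y = y2 \<otimes> c"
    using y by (rule local_divisor_memD)
  note mem = c x1(1) x2(1) y1(1) y2(1)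
  have xy: "x \<otimes>\<^bsub>local_divisor G c\<^esub> y = x2 \<otimes> c \<otimes> y1"
    using local_divisor_mult[OF c x2(1) y1(1)] by (simp only: x2(2)[symmetric] y1(2)[symmetric])
  have xy1: "x2 \<otimes> c \<otimes> y1 = c \<otimes> (x1 \<otimes> y1)"
    unfolding x2(2)[symmetric] x1(2) by (simp add: m_assoc mem)
  have "x2 \<otimes> c \<otimes> y1 = x2 \<otimes> (c \<otimes> y1)" by (simp add: m_assoc mem)
  also have "\<dots> = x2 \<otimes> y2 \<otimes> c"
    unfolding y1(2)[symmetric] y2(2) by (simp add: m_assoc mem)
  finally have xy2: "x2 \<otimes> c \<otimes> y1 = x2 \<otimes> y2 \<otimes> c" .
  show "x \<otimes>\<^bsub>local_divisor G c\<^esub> y \<in> carrier (local_divisor G c)"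
    unfolding xy by (rule local_divisor_memI[OF _ _ xy1 xy2]) (simp_all add: mem)
  fix z assume z: "z \<in> carrier (local_divisor G c)"
  obtain z1 z2 where z1: "z1 \<in> carrier G" "z = c \<otimes> z1" and z2: "z2 \<in> carrier G" "z = z2 \<otimes> c"
    using z by (rule local_divisor_memD)
  have "y \<otimes>\<^bsub>local_divisor G c\<^esub> z = y2 \<otimes> c \<otimes> z1"
    using local_divisor_mult[OF c y2(1) z1(1)] by (simp only: y2(2)[symmetric] z1(2)[symmetric])
  also have "\<dots> = c \<otimes> (y1 \<otimes> z1)"
    unfolding y2(2)[symmetric] y1(2) by (simp add: m_assoc mem z1(1))
  finally have yz: "y \<otimes>\<^bsub>local_divisor G c\<^esub> z = c \<otimes> (y1 \<otimes> z1)" .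
  have "x \<otimes>\<^bsub>local_divisor G c\<^esub> y \<otimes>\<^bsub>local_divisor G c\<^esub> z = x2 \<otimes> y2 \<otimes> c \<otimes> z1"
    unfolding xy xy2 z1(2) by (rule local_divisor_mult) (simp_all add: mem z1(1))
  also have "\<dots> = x2 \<otimes> c \<otimes> (y1 \<otimes> z1)"
    unfolding xy2[symmetric] by (simp add: m_assoc mem z1(1))
  also have "\<dots> = x \<otimes>\<^bsub>local_divisor G c\<^esub> (y \<otimes>\<^bsub>local_divisor G c\<^esub> z)"
    unfolding yz x2(2) by (rule local_divisor_mult[symmetric]) (simp_all add: mem z1(1))
  finally show "x \<otimes>\<^bsub>local_divisor G c\<^esub> y \<otimes>\<^bsub>local_divisor G c\<^esub> z
      = x \<otimes>\<^bsub>local_divisor G c\<^esub> (y \<otimes>\<^bsub>local_divisor G c\<^esub> z)" .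
next
  show "\<one>\<^bsub>local_divisor G c\<^esub> \<in> carrier (local_divisor G c)"
    using c by (intro local_divisor_memI[of \<one> \<one>]) simp_all
next
  fix x assume x: "x \<in> carrier (local_divisor G c)"
  obtain x1 x2 where "x1 \<in> carrier G" "x = c \<otimes> x1" "x2 \<in> carrier G" "x = x2 \<otimes> c"
    using x by (rule local_divisor_memD)
  then show "\<one>\<^bsub>local_divisor G c\<^esub> \<otimes>\<^bsub>local_divisor G c\<^esub> x = x"
      "x \<otimes>\<^bsub>local_divisor G c\<^esub> \<one>\<^bsub>local_divisor G c\<^esub> = x"
    using local_divisor_mult[OF c one_closed, of x1] local_divisor_mult[OF c _ one_closed, of x2] c
    by simp_all
qed

lemma local_divisor_sandwich_closed:
  assumes "c \<in> carrier G" "s \<in> carrier G"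
  shows "c \<otimes> s \<otimes> c \<in> carrier (local_divisor G c)"
  by (rule local_divisor_memI[of "s \<otimes> c" "c \<otimes> s"]) (simp_all add: assms m_assoc)

text \<open>The form \<open>x = x2 c\<close> absorbs the first \<open>c\<close> of
  \<open>c s c\<close>, and \<open>y = c y1\<close> the last one. So multiplying by
  \<open>c s c\<close> in the local divisor inserts an ordinary \<open>s\<close> between
  \<open>x\<close> and \<open>y\<close>.\<close>

lemma local_divisor_sandwich:
  assumes c: "c \<in> carrier G" and s: "s \<in> carrier G"
    and x: "x \<in> carrier (local_divisor G c)" and y: "y \<in> carrier (local_divisor G c)"
  shows "x \<otimes>\<^bsub>local_divisor G c\<^esub> (c \<otimes> s \<otimes> c) \<otimes>\<^bsub>local_divisor G c\<^esub> y = x \<otimes> s \<otimes> y"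
proof -
  obtain x2 where x2: "x2 \<in> carrier G" "x = x2 \<otimes> c"
    using x by (rule local_divisor_memD)
  obtain y1 where y1: "y1 \<in> carrier G" "y = c \<otimes> y1"
    using y by (rule local_divisor_memD)
  have xG: "x \<in> carrier G" using c x2 by simp
  have "x \<otimes>\<^bsub>local_divisor G c\<^esub> (c \<otimes> s \<otimes> c) = (x2 \<otimes> c) \<otimes>\<^bsub>local_divisor G c\<^esub> (c \<otimes> (s \<otimes> c))"
    by (simp add: x2 c s m_assoc)
  also have "\<dots> = x \<otimes> (s \<otimes> c)"
    unfolding x2(2) by (rule local_divisor_mult) (simp_all add: c s x2(1))
  finally have "x \<otimes>\<^bsub>local_divisor G c\<^esub> (c \<otimes> s \<otimes> c) = x \<otimes> s \<otimes> c" by (simp add: xG c s m_assoc)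
  moreover have "(x \<otimes> s \<otimes> c) \<otimes>\<^bsub>local_divisor G c\<^esub> y = x \<otimes> s \<otimes> c \<otimes> y1"
    unfolding y1(2) by (rule local_divisor_mult) (simp_all add: c s xG y1(1))
  ultimately show ?thesis by (simp add: y1 xG c s m_assoc)
qed

text \<open>From \<open>\<one> = c y = z c\<close> it would follow that \<open>c\<close> is a unit.
  Hence the local divisor at a non-unit is strictly smaller than the monoid.\<close>

lemma one_notin_local_divisor:
  assumes "c \<in> carrier G" "c \<notin> Units G"
  shows "\<one> \<notin> carrier (local_divisor G c)"
proof
  assume "\<one> \<in> carrier (local_divisor G c)"
  then obtain y z where yz: "y \<in> carrier G" "\<one> = c \<otimes> y" "z \<in> carrier G" "\<one> = z \<otimes> c"
    by (rule local_divisor_memD)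
  have "z = y"
    by (rule inv_unique[of z c y]) (use yz(1,3) yz(2,4)[symmetric] assms(1) in simp_all)
  then show False using yz(1) yz(2,4)[symmetric] assms unfolding Units_def by blast
qed

end

section \<open>Monoids generated by a submonoid and one more element\<close>

text \<open>An element of the monoid generated by \<open>N\<close> and \<open>c\<close> that is not in \<open>N\<close> has the form
  \<open>n\<^sub>0 c n\<^sub>1 c \<dots> c n\<^sub>k\<close> with \<open>k \<ge> 1\<close>. Its outer blocks \<open>p = n\<^sub>0\<close> and \<open>q = n\<^sub>k\<close> are recorded by
  \<open>two_ended\<close>, and its inner part \<open>d = c n\<^sub>1 c \<dots> c\<close> is the product of the \<open>c n\<^sub>i c\<close> in the local
  divisor. In a product the gap between two such words becomes a new inner block \<open>c q p' c\<close>, which is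
  charged to the right factor; the left context \<open>u\<close> supplies \<open>q\<close>.\<close>

lemma (in monoid) divides_local_divisor:
  assumes N: "submonoid N G" and c: "c \<in> carrier G"
    and gen: "\<And>T. submonoid T G \<Longrightarrow> N \<subseteq> T \<Longrightarrow> c \<in> T \<Longrightarrow> T = carrier G"
  shows "divides (semigrp_of G)
    (block_product (semigrp_of (local_divisor G c)) (semigrp_of (two_ended (G\<lparr>carrier := N\<rparr>))))"
proof -
  interpret N: submonoid N G by fact
  interpret L: monoid "local_divisor G c" by (rule monoid_local_divisor[OF c])
  interpret W: monoid "two_ended (G\<lparr>carrier := N\<rparr>)"
    by (rule monoid.monoid_two_ended[OF N.submonoid_is_monoid[OF monoid_axioms]])
  let ?L = "local_divisor G c" and ?W = "two_ended (G\<lparr>carrier := N\<rparr>)"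
  let ?B = "block_product (semigrp_of ?L) (semigrp_of ?W)"
  let ?D = "carrier ?W \<times> carrier ?W"
  note NG = subsetD[OF N.subset]
  note LG = subsetD[OF local_divisor_subset[OF c]]
  have W_carrier: "carrier ?W = UNIV \<times> N \<times> N" by (simp add: two_ended_def)
  have W_mult: "(f, p, q) \<otimes>\<^bsub>?W\<^esub> (f', p', q') =
      (f \<or> f', if f then p else p \<otimes> p', if f' then q' else q \<otimes> q')" for f f' p q p' q'
    by (simp add: two_ended_def)
  define s where "s q p = c \<otimes> (q \<otimes> p) \<otimes> c" for q p
  have s: "s q p \<in> carrier ?L" if "p \<in> N" "q \<in> N" for p q
    unfolding s_def using that by (intro local_divisor_sandwich_closed c) (simp add: NG)
  have cL: "c \<in> carrier ?L" using L.one_closed by simp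
  have cl: "c \<otimes>\<^bsub>?L\<^esub> d = d" "d \<otimes>\<^bsub>?L\<^esub> c = d" if "d \<in> carrier ?L" for d
    using L.l_one[OF that] L.r_one[OF that] by simp_all
  \<comment> \<open>A word without \<open>c\<close> has no inner part and contributes
    \<open>c\<close>, the unit of the local divisor.\<close>
  define E where "E = (\<lambda>i\<in>?D. c)"
  \<comment> \<open>If a \<open>c\<close> occurs in the left context, its last block
    \<open>q\<close> and the first block \<open>p\<close> of the word form a new inner block
    \<open>s q p\<close> in front of \<open>d\<close>; otherwise \<open>d\<close> stands
    alone.\<close>
  define X where "X p d = (\<lambda>((f, _, q), _)\<in>?D. if f then s q p \<otimes>\<^bsub>?L\<^esub> d else d)" for p d
  define R where "R b m \<longleftrightarrow> (\<exists>n\<in>N. b = (E, False, n, n) \<and> m = n) \<or>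
    (\<exists>p\<in>N. \<exists>d\<in>carrier ?L. \<exists>q\<in>N. b = (X p d, True, p, q) \<and> m = p \<otimes> d \<otimes> q)" for b m
  have R1: "R (E, False, n, n) n" if "n \<in> N" for n
    using that unfolding R_def by blast
  have R2: "R (X p d, True, p, q) (p \<otimes> d \<otimes> q)" if "p \<in> N" "d \<in> carrier ?L" "q \<in> N" for p d q
    using that unfolding R_def by blast
  have R_cases: thesis if "R b m"
    and "\<And>n. n \<in> N \<Longrightarrow> b = (E, False, n, n) \<Longrightarrow> m = n \<Longrightarrow> thesis"
    and "\<And>p d q. p \<in> N \<Longrightarrow> d \<in> carrier ?L \<Longrightarrow> q \<in> N \<Longrightarrow> b = (X p d, True, p, q) \<Longrightarrow>
      m = p \<otimes> d \<otimes> q \<Longrightarrow> thesis" for b m thesis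
    using that unfolding R_def by blast
  have X_mem: "X p d \<in> ?D \<rightarrow>\<^sub>E carrier ?L" if "p \<in> N" "d \<in> carrier ?L" for p d
    using that by (auto simp: X_def W_carrier s)
  have X_at: "X p d ((f, p', q'), v) = (if f then s q' p \<otimes>\<^bsub>?L\<^esub> d else d)"
    if "p' \<in> N" "q' \<in> N" "v \<in> carrier ?W" for p d f p' q' v
    using that by (simp add: X_def W_carrier)
  have E_at: "E (u, v) = c" if "u \<in> carrier ?W" "v \<in> carrier ?W" for u v
    using that by (simp add: E_def)
  have B_mult: "(x, a) \<star>\<^bsub>?B\<^esub> (y, b) = (z, a \<otimes>\<^bsub>?W\<^esub> b)"
    if z: "z \<in> extensional ?D"
      and eq: "\<And>f p q v. p \<in> N \<Longrightarrow> q \<in> N \<Longrightarrow> v \<in> carrier ?W \<Longrightarrow>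
        x ((f, p, q), b \<otimes>\<^bsub>?W\<^esub> v) \<otimes>\<^bsub>?L\<^esub> y ((f, p, q) \<otimes>\<^bsub>?W\<^esub> a, v) = z ((f, p, q), v)"
    for x a y b z
  proof -
    have "(\<lambda>(u, v)\<in>?D. x (u, b \<otimes>\<^bsub>?W\<^esub> v) \<otimes>\<^bsub>?L\<^esub> y (u \<otimes>\<^bsub>?W\<^esub> a, v)) = restrict z ?D"
    proof (rule restrict_ext)
      fix i assume "i \<in> ?D"
      then obtain u v where i: "i = (u, v)" "u \<in> carrier ?W" "v \<in> carrier ?W" by blast
      moreover obtain f p q where "u = (f, p, q)" by (metis prod.exhaust)
      ultimately show "(case i of (u, v) \<Rightarrow> x (u, b \<otimes>\<^bsub>?W\<^esub> v) \<otimes>\<^bsub>?L\<^esub> y (u \<otimes>\<^bsub>?W\<^esub> a, v)) = z i"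
        using eq by (simp add: W_carrier)
    qed
    then show ?thesis using extensional_restrict[OF z] by (simp add: block_product_mult)
  qed
  have ext: "E \<in> extensional ?D" "X p d \<in> extensional ?D" for p d
    by (simp_all only: E_def X_def restrict_extensional)
  have mem: "(f, p, q) \<in> carrier ?W" if "p \<in> N" "q \<in> N" for f p q
    using that by (simp add: W_carrier)
  have EE: "(E, False, n, n) \<star>\<^bsub>?B\<^esub> (E, False, n', n') = (E, False, n \<otimes> n', n \<otimes> n')"
    if "n \<in> N" "n' \<in> N" for n n'
    using B_mult[of E E "(False, n', n')" E "(False, n, n)"] that ext
    by (simp add: W_mult E_at W.m_closed mem cl cL)
  have EX: "(E, False, n, n) \<star>\<^bsub>?B\<^esub> (X p d, True, p, q) = (X (n \<otimes> p) d, True, n \<otimes> p, q)"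
    if "n \<in> N" "p \<in> N" "d \<in> carrier ?L" "q \<in> N" for n p d q
  proof -
    \<comment> \<open>The element \<open>n\<close> may be joined to the last block of the context or
      to the first block of the word; the resulting inner block is the same.\<close>
    have "s (q' \<otimes> n) p = s q' (n \<otimes> p)" if "q' \<in> N" for q'
      unfolding s_def using that \<open>n \<in> N\<close> \<open>p \<in> N\<close> by (simp add: NG m_assoc)
    then show ?thesis
      using B_mult[of "X (n \<otimes> p) d" E "(True, p, q)" "X p d" "(False, n, n)"] that ext
      by (simp add: W_mult E_at X_at W.m_closed mem cl s)
  qed
  have XE: "(X p d, True, p, q) \<star>\<^bsub>?B\<^esub> (E, False, n, n) = (X p d, True, p, q \<otimes> n)"
    if "n \<in> N" "p \<in> N" "d \<in> carrier ?L" "q \<in> N" for n p d q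
    using B_mult[of "X p d" "X p d" "(False, n, n)" E "(True, p, q)"] that ext
    by (simp add: W_mult E_at X_at W.m_closed mem cl s)
  \<comment> \<open>The right factor always sees a \<open>c\<close> in its left context, the last
    block of which is \<open>q\<close>, and so contributes \<open>s q p'\<close>.\<close>
  have XX: "(X p d, True, p, q) \<star>\<^bsub>?B\<^esub> (X p' d', True, p', q')
      = (X p (d \<otimes>\<^bsub>?L\<^esub> s q p' \<otimes>\<^bsub>?L\<^esub> d'), True, p, q')"
    if "p \<in> N" "d \<in> carrier ?L" "q \<in> N" "p' \<in> N" "d' \<in> carrier ?L" "q' \<in> N" for p d q p' d' q'
    using B_mult[of "X p (d \<otimes>\<^bsub>?L\<^esub> s q p' \<otimes>\<^bsub>?L\<^esub> d')" "X p d" "(True, p', q')" "X p' d'" "(True, p, q)"]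
      that ext
    by (simp add: W_mult X_at W.m_closed mem s L.m_assoc)
  have E_mem: "E \<in> ?D \<rightarrow>\<^sub>E carrier ?L"
    by (auto simp: E_def cL)
  have R_carrier: "b \<in> carrier ?B \<and> m \<in> carrier G" if "R b m" for b m
    using that
    by (rule R_cases) (simp_all add: block_product_carrier X_mem E_mem mem NG LG)
  have R_mult: "R (b \<star>\<^bsub>?B\<^esub> b') (m \<otimes> m')" if R: "R b m" "R b' m'" for b m b' m'
    using R(1)
  proof (rule R_cases)
    fix n assume b: "n \<in> N" "b = (E, False, n, n)" "m = n"
    show ?thesis
      using R(2)
    proof (rule R_cases)
      fix n' assume b': "n' \<in> N" "b' = (E, False, n', n')" "m' = n'"
      show ?thesis using b b' R1 by (simp add: EE)
    next
      fix p d q assume b': "p \<in> N" "d \<in> carrier ?L" "q \<in> N" "b' = (X p d, True, p, q)" "m' = p \<otimes> d \<otimes> q"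
      then have "R (b \<star>\<^bsub>?B\<^esub> b') (n \<otimes> p \<otimes> d \<otimes> q)" using b R2 by (simp add: EX)
      then show ?thesis using b b' by (simp add: NG LG m_assoc)
    qed
  next
    fix p d q assume b: "p \<in> N" "d \<in> carrier ?L" "q \<in> N" "b = (X p d, True, p, q)" "m = p \<otimes> d \<otimes> q"
    show ?thesis
      using R(2)
    proof (rule R_cases)
      fix n assume b': "n \<in> N" "b' = (E, False, n, n)" "m' = n"
      then have "R (b \<star>\<^bsub>?B\<^esub> b') (p \<otimes> d \<otimes> (q \<otimes> n))" using b R2 by (simp add: XE)
      then show ?thesis using b b' by (simp add: NG LG m_assoc)
    next
      fix p' d' q'
      assume b': "p' \<in> N" "d' \<in> carrier ?L" "q' \<in> N" "b' = (X p' d', True, p', q')" "m' = p' \<otimes> d' \<otimes> q'"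
      then have "R (b \<star>\<^bsub>?B\<^esub> b') (p \<otimes> (d \<otimes>\<^bsub>?L\<^esub> s q p' \<otimes>\<^bsub>?L\<^esub> d') \<otimes> q')"
        using b R2 s by (simp add: XX)
      moreover have "d \<otimes>\<^bsub>?L\<^esub> s q p' \<otimes>\<^bsub>?L\<^esub> d' = d \<otimes> (q \<otimes> p') \<otimes> d'"
        unfolding s_def using b b' by (intro local_divisor_sandwich c) (simp_all add: NG)
      ultimately show ?thesis using b b' by (simp add: NG LG m_assoc)
    qed
  qed
  have R_fun: "m = m'" if R: "R b m" "R b m'" for b m m'
  proof -
    \<comment> \<open>The unit context contains no \<open>c\<close>, so the inner part
      \<open>d\<close> can be read off there.\<close>
    have X_one: "X p d ((False, \<one>, \<one>), (False, \<one>, \<one>)) = d" for p d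
      by (simp add: X_at mem)
    have X_inj: "d = d'" if "X p d = X p d'" for p d d'
      using fun_cong[OF that, of "((False, \<one>, \<one>), (False, \<one>, \<one>))"] by (simp only: X_one)
    from R(1) show ?thesis
    proof (rule R_cases)
      fix n assume b: "n \<in> N" "b = (E, False, n, n)" "m = n"
      from R(2) show ?thesis by (rule R_cases) (simp_all add: b)
    next
      fix p d q assume b: "p \<in> N" "d \<in> carrier ?L" "q \<in> N" "b = (X p d, True, p, q)" "m = p \<otimes> d \<otimes> q"
      from R(2) show ?thesis
      proof (rule R_cases)
        fix p' d' q' assume "b = (X p' d', True, p', q')" and m': "m' = p' \<otimes> d' \<otimes> q'"
        then have "X p d = X p d'" "p' = p" "q' = q" using b by auto
        then show ?thesis using X_inj b m' by blast
      qed (simp add: b)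
    qed
  qed
  \<comment> \<open>Surjectivity comes from generation: the covered elements form a submonoid
    containing \<open>N\<close> and \<open>c\<close>, the latter as the word with both outer blocks
    \<open>\<one>\<close> and inner part \<open>c\<close>.\<close>
  have onto: "{m. \<exists>b. R b m} = carrier G"
  proof (rule gen)
    show "submonoid {m. \<exists>b. R b m} G"
    proof
      show "{m. \<exists>b. R b m} \<subseteq> carrier G" using R_carrier by blast
      show "\<one> \<in> {m. \<exists>b. R b m}" using R1[OF N.one_closed] by blast
    qed (use R_mult in blast)
    show "N \<subseteq> {m. \<exists>b. R b m}" using R1 by blast
    show "c \<in> {m. \<exists>b. R b m}" using R2[OF N.one_closed cL N.one_closed] c by auto
  qed
  have "division R (semigrp_of G) ?B"
  proof (rule divisionI)
    fix m assume "m \<in> carrier (semigrp_of G)"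
    then have "m \<in> {m. \<exists>b. R b m}" by (simp only: onto semigrp_of_simps)
    then show "\<exists>b. R b m" by (rule CollectD)
  qed (use R_carrier R_mult R_fun in simp_all)
  then show ?thesis
    unfolding divides_iff_division using one_closed by auto
qed

text \<open>The units form a proper submonoid because \<open>G\<close> is not a group. Take
  \<open>N\<close> maximal among the proper submonoids containing them, and any \<open>c\<close>
  outside \<open>N\<close>. Then \<open>c\<close> is not a unit, and maximality leaves only the
  whole monoid above \<open>N\<close> and \<open>c\<close>.\<close>

lemma (in monoid) exists_maximal_submonoid:
  assumes "finite (carrier G)" "\<not> group G"
  obtains N c where "submonoid N G" "N \<noteq> carrier G" "c \<in> carrier G" "c \<notin> Units G"
    "\<And>T. submonoid T G \<Longrightarrow> N \<subseteq> T \<Longrightarrow> c \<in> T \<Longrightarrow> T = carrier G"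
proof -
  define F where "F = {N. submonoid N G \<and> Units G \<subseteq> N \<and> N \<noteq> carrier G}"
  have "\<not> carrier G \<subseteq> Units G"
    using assms(2) group.intro[OF monoid_axioms group_axioms.intro] by blast
  moreover have "submonoid (Units G) G"
    by (rule submonoid.intro) (simp_all add: subsetI Units_closed)
  ultimately have "Units G \<in> F" by (auto simp: F_def)
  moreover have "finite F"
    by (rule finite_subset[of _ "Pow (carrier G)"])
      (use assms(1) submonoid.subset in \<open>auto simp only: F_def finite_Pow_iff\<close>)
  ultimately have "\<exists>N\<in>F. Units G \<subseteq> N \<and> (\<forall>T\<in>F. N \<subseteq> T \<longrightarrow> N = T)"
    by (intro finite_has_maximal2)
  then obtain N where N: "N \<in> F" and max: "\<forall>T\<in>F. N \<subseteq> T \<longrightarrow> N = T"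
    by (elim bexE conjE) (rule that)
  have sub: "submonoid N G" "Units G \<subseteq> N" "N \<noteq> carrier G" using N unfolding F_def by blast+
  have "N \<subset> carrier G" using submonoid.subset[OF sub(1)] sub(3) by (rule psubsetI)
  then obtain c where "c \<in> carrier G - N" using psubset_imp_ex_mem by blast
  then have c: "c \<in> carrier G" "c \<notin> N" by simp_all
  show ?thesis
  proof (rule that[of N c])
    fix T assume "submonoid T G" "N \<subseteq> T" "c \<in> T"
    with c sub max show "T = carrier G" unfolding F_def by (metis (mono_tags, lifting) mem_Collect_eq order_trans)
  qed (use sub c in auto)
qed

text \<open>Induction on the order. \<open>N\<close> is smaller because it is proper, the local
  divisor because it misses the unit; both have the type of \<open>M\<close>, so the induction
  hypothesis applies to them.\<close>

lemma decomposable_monoid: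
  fixes M :: "'a monoid"
  assumes "monoid M" "finite (carrier M)"
  shows "decomposable (semigrp_of M)"
  using assms
proof (induction "order M" arbitrary: M rule: less_induct)
  case less
  interpret monoid M by fact
  show ?case
  proof (cases "group M")
    case True
    then show ?thesis using decomposable_group less.prems(2) by blast
  next
    case False
    obtain N c where N: "submonoid N M" "N \<noteq> carrier M" and c: "c \<in> carrier M" "c \<notin> Units M"
      and gen: "\<And>T. submonoid T M \<Longrightarrow> N \<subseteq> T \<Longrightarrow> c \<in> T \<Longrightarrow> T = carrier M"
      using exists_maximal_submonoid[OF less.prems(2) False] by metis
    let ?N = "M\<lparr>carrier := N\<rparr>" and ?L = "local_divisor M c"
    have monoids: "monoid ?N" "monoid ?L"
      using submonoid.submonoid_is_monoid[OF N(1)] monoid_axioms monoid_local_divisor[OF c(1)] by auto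
    have sub: "carrier ?N \<subset> carrier M" "carrier ?L \<subset> carrier M"
      using N submonoid.subset local_divisor_subset[OF c(1)] one_notin_local_divisor[OF c] by auto
    have "decomposable (semigrp_of K)" if K: "monoid K" "carrier K \<subset> carrier M" for K :: "'a monoid"
    proof (rule less.hyps)
      show "order K < order M"
        unfolding order_def by (rule psubset_card_mono[OF less.prems(2) K(2)])
    qed (use K less.prems(2) finite_subset in auto)
    note decs = this[OF monoids(1) sub(1)] this[OF monoids(2) sub(2)]
    show ?thesis
      by (intro decomposable_divides[OF divides_local_divisor[OF N(1) c(1) gen]]
          decomposable_block_product monoid.decomposable_two_ended monoid.semigrp_semigrp_of
          monoid.monoid_two_ended monoids decs)
  qed
qed

theorem corollary2:
  fixes A :: "'a semigrp"
  assumes "semigrp A" and "finite (carrier A)"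
  shows "\<exists>B :: nat elem semigrp. iterated_lr_product basic_factor B \<and> divides A B"
proof -
  interpret semigrp A by fact
  \<comment> \<open>A new unit \<open>None\<close> is adjoined whether or not \<open>A\<close>
    already has one, so that \<open>Some\<close> embeds \<open>A\<close> uniformly.\<close>
  define M :: "'a option monoid" where
    "M = \<lparr>carrier = insert None (Some ` carrier A),
       monoid.mult = (\<lambda>x y. case x of None \<Rightarrow> y | Some a \<Rightarrow>
         (case y of None \<Rightarrow> x | Some b \<Rightarrow> Some (a \<star>\<^bsub>A\<^esub> b))),
       one = None\<rparr>"
  have "monoid M"
    by standard (auto simp: M_def closed assoc)
  moreover have "finite (carrier M)" using assms(2) by (simp add: M_def)
  ultimately have "decomposable (semigrp_of M)" by (rule decomposable_monoid)
  moreover have "divides A (semigrp_of M)"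
    by (rule divides_embedding[of _ Some]) (use assms in \<open>auto simp: semigrp_hom_def M_def\<close>)
  ultimately show ?thesis using decomposable_divides unfolding decomposable_def by blast
qed

end
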